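(* Let $E_{8,1}$ be the weighted tree with vertices $E_0,E_1,\dots,E_7$, where $E_0$ has weight $3$, all other vertices have weight $2$, and the edges are those of the chain $E_0 - E_1 - E_2 - E_3 - E_4 - E_5 - E_6$ together with one edge joining $E_7$ and $E_4$. Then the number of elements of the triple root system $R(E_{8,1})$ is $238$.
   Context: For a finite weighted tree $\Gamma$ with vertices $V_i$ of weights $w_i$, the intersection form on $\bigoplus_i\mathbb{Z}V_i$ is the symmetric bilinear form with $(V_i\cdot V_i)=-w_i$ and, for $i\neq j$, $(V_i\cdot V_j)=1$ if $V_i$ and $V_j$ are joined by an edge and $0$ otherwise. A non-zero element $\sum m_iV_i$ is a positive (resp. negative) divisor if all $m_i\ge 0$ (resp. all $m_i\le 0$). The triple root system $R(\Gamma)$ is the set of all positive and negative divisors $Y$ with $(Y\cdot Y)=-2$ or $(Y\cdot Y)=-3$. *)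

theory Defs
  imports "HOL-Library.Poly_Mapping" "HOL-Algebra.Free_Abelian_Groups"
begin

record 'a wgraph =
  verts :: "'a set"
  edges :: "'a set set"
  weight :: "'a \<Rightarrow> int"

definition adj_rel :: "'a wgraph \<Rightarrow> ('a \<times> 'a) set" where
  "adj_rel \<Gamma> = {(u, v). {u, v} \<in> edges \<Gamma>}"

definition cycle :: "'a wgraph \<Rightarrow> 'a list \<Rightarrow> bool" where
  "cycle \<Gamma> c \<longleftrightarrow> length c \<ge> 3 \<and> distinct c \<and>
     (\<forall>i < length c. {c ! i, c ! (Suc i mod length c)} \<in> edges \<Gamma>)"

definition weighted_tree :: "'a wgraph \<Rightarrow> bool" where
  "weighted_tree \<Gamma> \<longleftrightarrow>
     finite (verts \<Gamma>) \<and> verts \<Gamma> \<noteq> {} \<and>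
     (\<forall>e \<in> edges \<Gamma>. \<exists>u \<in> verts \<Gamma>. \<exists>v \<in> verts \<Gamma>. u \<noteq> v \<and> e = {u, v}) \<and>
     (\<forall>u \<in> verts \<Gamma>. \<forall>v \<in> verts \<Gamma>. (u, v) \<in> (adj_rel \<Gamma>)\<^sup>*) \<and>
     (\<nexists>c. cycle \<Gamma> c)"

definition vertex_product :: "'a wgraph \<Rightarrow> 'a \<Rightarrow> 'a \<Rightarrow> int" where
  "vertex_product \<Gamma> u v =
     (if u = v then - weight \<Gamma> u else if {u, v} \<in> edges \<Gamma> then 1 else 0)"

text \<open>The lattice \<open>\<Oplus>\<^sub>i \<int> V\<^sub>i\<close> is the library's free abelian group on the vertex set, whose elements
  are the finitely supported functions \<open>'a \<Rightarrow>\<^sub>0 int\<close> with support in \<open>verts \<Gamma>\<close>; the form below is the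
  bilinear extension of \<^const>\<open>vertex_product\<close>.\<close>

definition intersection_form :: "'a wgraph \<Rightarrow> ('a \<Rightarrow>\<^sub>0 int) \<Rightarrow> ('a \<Rightarrow>\<^sub>0 int) \<Rightarrow> int" where
  "intersection_form \<Gamma> X Y =
     (\<Sum>u \<in> verts \<Gamma>. \<Sum>v \<in> verts \<Gamma>. Poly_Mapping.lookup X u * Poly_Mapping.lookup Y v * vertex_product \<Gamma> u v)"

definition positive_divisor :: "'a wgraph \<Rightarrow> ('a \<Rightarrow>\<^sub>0 int) \<Rightarrow> bool" where
  "positive_divisor \<Gamma> Y \<longleftrightarrow>
     Y \<in> carrier (free_Abelian_group (verts \<Gamma>)) \<and> Y \<noteq> 0 \<and> (\<forall>v \<in> verts \<Gamma>. Poly_Mapping.lookup Y v \<ge> 0)"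

definition negative_divisor :: "'a wgraph \<Rightarrow> ('a \<Rightarrow>\<^sub>0 int) \<Rightarrow> bool" where
  "negative_divisor \<Gamma> Y \<longleftrightarrow>
     Y \<in> carrier (free_Abelian_group (verts \<Gamma>)) \<and> Y \<noteq> 0 \<and> (\<forall>v \<in> verts \<Gamma>. Poly_Mapping.lookup Y v \<le> 0)"

definition triple_root_system :: "'a wgraph \<Rightarrow> ('a \<Rightarrow>\<^sub>0 int) set" where
  "triple_root_system \<Gamma> =
     {Y. (positive_divisor \<Gamma> Y \<or> negative_divisor \<Gamma> Y) \<and>
         (intersection_form \<Gamma> Y Y = -2 \<or> intersection_form \<Gamma> Y Y = -3)}"

text \<open>The vertex \<open>E\<^sub>i\<close> is represented by the natural number \<open>i\<close>.\<close>

definition E8_1 :: "nat wgraph" where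
  "E8_1 = \<lparr>verts = {0..7},
           edges = {{0,1}, {1,2}, {2,3}, {3,4}, {4,5}, {5,6}, {7,4}},
           weight = (\<lambda>i. if i = 0 then 3 else 2)\<rparr>"

lemma cycle_two_neighbours:
  assumes "cycle \<Gamma> c" "x \<in> set c"
  obtains y z where "y \<in> set c" "z \<in> set c" "y \<noteq> z" "{x, y} \<in> edges \<Gamma>" "{x, z} \<in> edges \<Gamma>"
proof -
  let ?n = "length c"
  have n: "?n \<ge> 3" and d: "distinct c"
    and e: "\<And>i. i < ?n \<Longrightarrow> {c ! i, c ! (Suc i mod ?n)} \<in> edges \<Gamma>"
    using assms(1) by (auto simp: cycle_def)
  obtain i where i: "i < ?n" "x = c ! i" using assms(2) by (auto simp: in_set_conv_nth)
  define j where "j = (if i = 0 then ?n - 1 else i - 1)"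
  have j: "j < ?n" "Suc j mod ?n = i" using i n by (auto simp: j_def)
  have k: "Suc i mod ?n < ?n" using n by (intro mod_less_divisor) linarith
  have "Suc i mod ?n \<noteq> j"
    using i n by (cases "Suc i = ?n") (auto simp: j_def)
  then have "c ! (Suc i mod ?n) \<noteq> c ! j" using d j k by (simp add: nth_eq_iff_index_eq)
  moreover have "{x, c ! j} \<in> edges \<Gamma>" using e[OF j(1)] j(2) i by (simp add: insert_commute)
  ultimately show thesis using that k j e[OF i(1)] i by (metis nth_mem)
qed

lemma weighted_tree_E8_1: "weighted_tree E8_1"
proof -
  let ?r = "adj_rel E8_1"
  have "sym ?r" by (auto simp: sym_def adj_rel_def insert_commute)
  then have sym: "sym (?r\<^sup>*)" by (rule sym_rtrancl)
  have adj: "(0,1) \<in> ?r" "(1,2) \<in> ?r" "(2,3) \<in> ?r" "(3,4) \<in> ?r" "(4,5) \<in> ?r" "(5,6) \<in> ?r"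
      "(4,7) \<in> ?r"
    by (auto simp: adj_rel_def E8_1_def insert_commute)
  have to0: "(0,v) \<in> ?r\<^sup>*" if "v \<in> verts E8_1" for v
  proof -
    have 1: "(0,1) \<in> ?r\<^sup>*" using adj by blast
    have 2: "(0,2) \<in> ?r\<^sup>*" using 1 adj by (meson rtrancl.rtrancl_into_rtrancl)
    have 3: "(0,3) \<in> ?r\<^sup>*" using 2 adj by (meson rtrancl.rtrancl_into_rtrancl)
    have 4: "(0,4) \<in> ?r\<^sup>*" using 3 adj by (meson rtrancl.rtrancl_into_rtrancl)
    have 5: "(0,5) \<in> ?r\<^sup>*" using 4 adj by (meson rtrancl.rtrancl_into_rtrancl)
    have 6: "(0,6) \<in> ?r\<^sup>*" using 5 adj by (meson rtrancl.rtrancl_into_rtrancl)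
    have 7: "(0,7) \<in> ?r\<^sup>*" using 4 adj by (meson rtrancl.rtrancl_into_rtrancl)
    have "v \<in> {0,1,2,3,4,5,6,7}" using that by (auto simp: E8_1_def)
    then show ?thesis using 1 2 3 4 5 6 7 by blast
  qed
  have conn: "(u,v) \<in> ?r\<^sup>*" if "u \<in> verts E8_1" "v \<in> verts E8_1" for u v
    using to0[OF that(1)] to0[OF that(2)] sym by (meson rtrancl_trans symD)
  have "\<not> cycle E8_1 c" for c
  proof
    assume c: "cycle E8_1 c"
    have nb: "\<exists>y z. y \<in> set c \<and> z \<in> set c \<and> y \<noteq> z \<and> {x,y} \<in> edges E8_1 \<and> {x,z} \<in> edges E8_1"
      if "x \<in> set c" for x
      using cycle_two_neighbours[OF c that] by metis
    note [simp] = E8_1_def doubleton_eq_iff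
    have 0: "0 \<notin> set c" using nb[of 0] by auto
    have 1: "1 \<notin> set c" using nb[of 1] 0 by auto
    have 2: "2 \<notin> set c" using nb[of 2] 1 by auto
    have 3: "3 \<notin> set c" using nb[of 3] 2 by auto
    have 7: "7 \<notin> set c" using nb[of 7] by auto
    have 6: "6 \<notin> set c" using nb[of 6] by auto
    have 5: "5 \<notin> set c" using nb[of 5] 6 by auto
    have 4: "4 \<notin> set c" using nb[of 4] 3 5 7 by auto
    obtain x where x: "x \<in> set c" using c by (cases c) (auto simp: cycle_def)
    obtain y where "{x,y} \<in> edges E8_1" using nb[OF x] by blast
    then have "x \<in> {0,1,2,3,4,5,6,7}" by auto
    then show False using x 0 1 2 3 4 5 6 7 by blast
  qed
  then have acyc: "\<nexists>c. cycle E8_1 c" by blast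
  have "\<exists>u \<in> verts E8_1. \<exists>v \<in> verts E8_1. u \<noteq> v \<and> e = {u, v}" if "e \<in> edges E8_1" for e
  proof -
    have "e \<in> {{0,1}, {1,2}, {2,3}, {3,4}, {4,5}, {5,6}, {7,4}}"
      using that unfolding E8_1_def by (simp only: wgraph.simps)
    then obtain a b where "e = {a, b}" "a \<in> {0..7}" "b \<in> {0..7}" "a \<noteq> b"
      by (elim insertE emptyE; simp)
    then show ?thesis unfolding E8_1_def wgraph.simps by blast
  qed
  moreover have "finite (verts E8_1)" "verts E8_1 \<noteq> {}" by (auto simp: E8_1_def)
  ultimately show ?thesis
    using conn acyc unfolding weighted_tree_def by blast
qed

end

theory Submission
  imports Defs
begin

text \<open>Eliminating the vertices of \<open>E\<^sub>8\<^sub>,\<^sub>1\<close> from the leaves towards the branch vertex \<open>E\<^sub>4\<close> writes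
  \<open>-630 (Y \<cdot> Y)\<close> as a sum of eight squares with positive coefficients. A divisor with
  \<open>-(Y \<cdot> Y) \<le> 3\<close> therefore satisfies \<open>m\<^sub>4 \<le> 7\<close>, and each further square bounds one more coefficient
  in terms of its neighbour. The resulting finite search yields 119 positive roots, and
  negation exchanges the positive and the negative ones.\<close>

text \<open>Entry i of the list is the coefficient of E_i; integer lists keep the search
  executable.\<close>

definition divisor_square :: "int list \<Rightarrow> int" where
  "divisor_square m =
     - 3 * (m!0)^2 - 2 * (m!1)^2 - 2 * (m!2)^2 - 2 * (m!3)^2 - 2 * (m!4)^2 - 2 * (m!5)^2
     - 2 * (m!6)^2 - 2 * (m!7)^2
     + 2 * (m!0 * m!1 + m!1 * m!2 + m!2 * m!3 + m!3 * m!4 + m!4 * m!5 + m!5 * m!6 + m!7 * m!4)"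

text \<open>Completing squares gives the pivots 3, 5/3, 7/5, 9/7 for a, b, c, d, then 2, 3/2 for g,
  f and 2 for h; what remains for e is 2 - 7/9 - 2/3 - 1/2 = 1/18. The factor 630 clears all
  denominators.\<close>

lemma divisor_square_sum_of_squares:
  "- 630 * divisor_square [a, b, c, d, e, f, g, h] =
     35 * e^2 + 10 * (9 * d - 7 * e)^2 + 18 * (7 * c - 5 * d)^2 + 42 * (5 * b - 3 * c)^2
     + 210 * (3 * a - b)^2 + 105 * (3 * f - 2 * e)^2 + 315 * (2 * g - f)^2 + 315 * (2 * h - e)^2"
  by (simp add: divisor_square_def power2_eq_square algebra_simps)

text \<open>The argument \<open>r\<close> is the part of the budget \<open>630 \<cdot> 3 = 1890\<close> not yet spent on squares.\<close>

definition admissible :: "int \<Rightarrow> int \<Rightarrow> int \<Rightarrow> int \<Rightarrow> (int \<times> int) list" where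
  "admissible r k p s =
     concat (map (\<lambda>x. let t = r - k * (p * x - s)^2 in if 0 \<le> t then [(x, t)] else []) [0..7])"

text \<open>The vertices are visited from E_4 outwards, so each later square involves one new
  coefficient and an already chosen neighbour. The final budget is 1890 plus 630 times
  \<open>divisor_square\<close>, so 0 and 630 stand for the values -3 and -2.\<close>

definition positive_roots :: "int list list" where
  "positive_roots =
     concat (map (\<lambda>(e, r).
     concat (map (\<lambda>(h, r).
     concat (map (\<lambda>(f, r).
     concat (map (\<lambda>(g, r).
     concat (map (\<lambda>(d, r).
     concat (map (\<lambda>(c, r).
     concat (map (\<lambda>(b, r).
     concat (map (\<lambda>(a, r). if r = 0 \<or> r = 630 then [[a, b, c, d, e, f, g, h]] else [])
       (admissible r 210 3 b)))
       (admissible r 42 5 (3 * c))))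
       (admissible r 18 7 (5 * d))))
       (admissible r 10 9 (7 * e))))
       (admissible r 315 2 f)))
       (admissible r 105 3 (2 * e))))
       (admissible r 315 2 e)))
       (admissible 1890 35 1 0))"

lemma distinct_positive_roots: "distinct positive_roots"
  and length_positive_roots: "length positive_roots = 119"
  by code_simp+

lemma in_admissible:
  "(x, t) \<in> set (admissible r k p s) \<longleftrightarrow>
     0 \<le> x \<and> x \<le> 7 \<and> 0 \<le> t \<and> t = r - k * (p * x - s)^2"
  by (auto simp: admissible_def Let_def)

lemma in_set_concat_map_prod:
  "y \<in> set (concat (map (\<lambda>(x, t). f x t) xs)) \<longleftrightarrow> (\<exists>x t. (x, t) \<in> set xs \<and> y \<in> set (f x t))"
  by force

text \<open>Squaring is monotone on nonnegative integers. In use, n is the integer part of the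
  square root of r / k, and the strict inequality is checked on numerals.\<close>

lemma square_le_bound:
  fixes y :: int
  assumes "k * y^2 \<le> r" "r < k * (n + 1)^2" "0 < k" "0 \<le> n"
  shows "y \<le> n"
proof (rule ccontr)
  assume "\<not> y \<le> n"
  then have "(n + 1)^2 \<le> y^2" using assms(4) by (intro power_mono) auto
  then have "k * (n + 1)^2 \<le> k * y^2" using assms(3) by simp
  then show False using assms by linarith
qed

lemma in_positive_roots:
  "m \<in> set positive_roots \<longleftrightarrow>
     length m = 8 \<and> (\<forall>x \<in> set m. 0 \<le> x) \<and> (divisor_square m = -2 \<or> divisor_square m = -3)"
  (is "_ \<longleftrightarrow> ?R")
proof
  assume "m \<in> set positive_roots"
  then obtain a b c d e f g h r where m: "m = [a, b, c, d, e, f, g, h]"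
    and nonneg: "0 \<le> a" "0 \<le> b" "0 \<le> c" "0 \<le> d" "0 \<le> e" "0 \<le> f" "0 \<le> g" "0 \<le> h"
    and r: "r = 0 \<or> r = 630" "r = 1890 - 35 * (1 * e - 0)^2 - 315 * (2 * h - e)^2
      - 105 * (3 * f - 2 * e)^2 - 315 * (2 * g - f)^2 - 10 * (9 * d - 7 * e)^2
      - 18 * (7 * c - 5 * d)^2 - 42 * (5 * b - 3 * c)^2 - 210 * (3 * a - b)^2"
    unfolding positive_roots_def in_set_concat_map_prod in_admissible
    by (elim exE conjE) (simp only: split: if_splits, simp_all)
  have "r = 1890 + 630 * divisor_square m"
    using r(2) divisor_square_sum_of_squares[of a b c d e f g h] unfolding m by simp
  with r(1) have "divisor_square m = -2 \<or> divisor_square m = -3" by linarith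
  then show ?R using m nonneg by auto
next
  assume R: ?R
  then obtain a b c d e f g h where m: "m = [a, b, c, d, e, f, g, h]"
    by (auto simp: numeral_eq_Suc length_Suc_conv)
  have nonneg: "0 \<le> a" "0 \<le> b" "0 \<le> c" "0 \<le> d" "0 \<le> e" "0 \<le> f" "0 \<le> g" "0 \<le> h"
    using R m by auto
  \<comment> \<open>The budgets left after each level of the search; \<open>1 * e - 0\<close> keeps
    the shape \<open>p * x - s\<close> of \<open>admissible\<close>.\<close>
  define r1 where "r1 = 1890 - 35 * (1 * e - 0)^2"
  define r2 where "r2 = r1 - 315 * (2 * h - e)^2"
  define r3 where "r3 = r2 - 105 * (3 * f - 2 * e)^2"
  define r4 where "r4 = r3 - 315 * (2 * g - f)^2"
  define r5 where "r5 = r4 - 10 * (9 * d - 7 * e)^2"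
  define r6 where "r6 = r5 - 18 * (7 * c - 5 * d)^2"
  define r7 where "r7 = r6 - 42 * (5 * b - 3 * c)^2"
  define r8 where "r8 = r7 - 210 * (3 * a - b)^2"
  note r = r1_def r2_def r3_def r4_def r5_def r6_def r7_def r8_def
  have r8: "r8 = 0 \<or> r8 = 630"
    using R divisor_square_sum_of_squares[of a b c d e f g h] unfolding m r by auto
  have sq: "0 \<le> (1 * e - 0)^2" "0 \<le> (2 * h - e)^2" "0 \<le> (3 * f - 2 * e)^2" "0 \<le> (2 * g - f)^2"
    "0 \<le> (9 * d - 7 * e)^2" "0 \<le> (7 * c - 5 * d)^2" "0 \<le> (5 * b - 3 * c)^2" "0 \<le> (3 * a - b)^2"
    by simp_all
  \<comment> \<open>Each budget is the next one plus a multiple of a square, so nonnegativity passes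
    from \<open>r8\<close> back to \<open>r1\<close>.\<close>
  have pos: "0 \<le> r1" "0 \<le> r2" "0 \<le> r3" "0 \<le> r4" "0 \<le> r5" "0 \<le> r6" "0 \<le> r7" "0 \<le> r8"
    using r8 sq r by linarith+
  have terms: "35 * (1 * e - 0)^2 \<le> 1890" "315 * (2 * h - e)^2 \<le> 1890"
    "105 * (3 * f - 2 * e)^2 \<le> 1890" "315 * (2 * g - f)^2 \<le> 1890"
    "10 * (9 * d - 7 * e)^2 \<le> 1890" "18 * (7 * c - 5 * d)^2 \<le> 1890"
    "42 * (5 * b - 3 * c)^2 \<le> 1890" "210 * (3 * a - b)^2 \<le> 1890"
    using pos sq unfolding r by linarith+
  have "1 * e - 0 \<le> 7" "2 * h - e \<le> 2" "3 * f - 2 * e \<le> 4" "2 * g - f \<le> 2"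
    "9 * d - 7 * e \<le> 13" "7 * c - 5 * d \<le> 10" "5 * b - 3 * c \<le> 6" "3 * a - b \<le> 3"
    by (rule square_le_bound[OF terms(1)] square_le_bound[OF terms(2)] square_le_bound[OF terms(3)]
      square_le_bound[OF terms(4)] square_le_bound[OF terms(5)] square_le_bound[OF terms(6)]
      square_le_bound[OF terms(7)] square_le_bound[OF terms(8)]; simp)+
  \<comment> \<open>From e \<le> 7 the bounds spread outwards along the edges, so the range
    \<open>[0..7]\<close> in \<open>admissible\<close> loses no solution.\<close>
  then have le: "e \<le> 7" "h \<le> 7" "f \<le> 7" "g \<le> 7" "d \<le> 7" "c \<le> 7" "b \<le> 7" "a \<le> 7"
    by linarith+
  have 1: "(e, r1) \<in> set (admissible 1890 35 1 0)"
    and 2: "(h, r2) \<in> set (admissible r1 315 2 e)"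
    and 3: "(f, r3) \<in> set (admissible r2 105 3 (2 * e))"
    and 4: "(g, r4) \<in> set (admissible r3 315 2 f)"
    and 5: "(d, r5) \<in> set (admissible r4 10 9 (7 * e))"
    and 6: "(c, r6) \<in> set (admissible r5 18 7 (5 * d))"
    and 7: "(b, r7) \<in> set (admissible r6 42 5 (3 * c))"
    and 8: "(a, r8) \<in> set (admissible r7 210 3 b)"
    unfolding in_admissible using nonneg le pos r by blast+
  show "m \<in> set positive_roots"
    unfolding positive_roots_def in_set_concat_map_prod
    by (intro exI conjI, rule 1, rule 2, rule 3, rule 4, rule 5, rule 6, rule 7, rule 8)
      (use r8 in \<open>auto simp: m\<close>)
qed

text \<open>This links search and lattice. The double sum meets every edge twice, whence the factor
  2 of the mixed terms.\<close>

lemma intersection_form_E8_1_nth: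
  assumes "length m = 8"
  shows "intersection_form E8_1 (Poly_Mapping.nth m) (Poly_Mapping.nth m) = divisor_square m"
proof -
  have "{0..7::nat} = {0, 1, 2, 3, 4, 5, 6, 7}" by auto
  moreover obtain a b c d e f g h where "m = [a, b, c, d, e, f, g, h]"
    using assms by (auto simp: numeral_eq_Suc length_Suc_conv)
  ultimately show ?thesis
    by (simp add: intersection_form_def vertex_product_def E8_1_def divisor_square_def
        nth.rep_eq doubleton_eq_iff nth_default_def power2_eq_square algebra_simps)
qed

lemma intersection_form_uminus:
  "intersection_form \<Gamma> (- X) (- Y) = intersection_form \<Gamma> X Y"
  by (simp add: intersection_form_def)

lemma negative_divisor_iff: "negative_divisor \<Gamma> Y \<longleftrightarrow> positive_divisor \<Gamma> (- Y)"
  by (simp add: negative_divisor_def positive_divisor_def)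

text \<open>The two sign conditions kill the coefficients at vertices, the support condition kills
  all others, and 0 is excluded.\<close>

lemma positive_not_negative_divisor:
  assumes "positive_divisor \<Gamma> Y"
  shows "\<not> negative_divisor \<Gamma> Y"
proof
  assume n: "negative_divisor \<Gamma> Y"
  have "Poly_Mapping.lookup Y v = 0" for v
  proof (cases "v \<in> verts \<Gamma>")
    case True
    then show ?thesis using assms n
      by (auto simp: positive_divisor_def negative_divisor_def intro: antisym)
  next
    case False
    then show ?thesis using assms
      by (auto simp: positive_divisor_def in_keys_iff)
  qed
  then have "Y = 0" by (intro poly_mapping_eqI) simp
  then show False using n by (simp add: negative_divisor_def)
qed

lemma divisor_eq_nth:
  assumes "Poly_Mapping.keys Y \<subseteq> {0..<n}"
  shows "Y = Poly_Mapping.nth (map (Poly_Mapping.lookup Y) [0..<n])"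
  using assms by (intro poly_mapping_eqI) (auto simp: nth.rep_eq nth_default_def in_keys_iff)

text \<open>The length is fixed because trailing zeros are invisible in
  \<open>Poly_Mapping.nth\<close>.\<close>

lemma inj_on_poly_mapping_nth: "inj_on Poly_Mapping.nth {m. length m = n}"
proof (rule inj_onI)
  fix l m :: "'a list"
  assume lm: "l \<in> {m. length m = n}" "m \<in> {m. length m = n}"
    and eq: "Poly_Mapping.nth l = Poly_Mapping.nth m"
  have "nth_default 0 l = nth_default 0 m" using eq by (metis nth.rep_eq)
  then show "l = m" using lm
    by (intro nth_equalityI) (auto simp: nth_default_def fun_eq_iff split: if_splits)
qed

lemma positive_roots_E8_1:
  "{Y. positive_divisor E8_1 Y \<and> (intersection_form E8_1 Y Y = -2 \<or> intersection_form E8_1 Y Y = -3)}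
     = Poly_Mapping.nth ` set positive_roots" (is "?P = _")
proof (intro subset_antisym subsetI)
  fix Y assume Y: "Y \<in> ?P"
  let ?m = "map (Poly_Mapping.lookup Y) [0..<8]"
  have "Y = Poly_Mapping.nth ?m"
    using Y by (intro divisor_eq_nth) (force simp: positive_divisor_def E8_1_def)
  moreover from this have "?m \<in> set positive_roots"
    using Y intersection_form_E8_1_nth[of ?m]
    by (auto simp: in_positive_roots positive_divisor_def E8_1_def simp del: upt_rec_numeral)
  ultimately show "Y \<in> Poly_Mapping.nth ` set positive_roots" by blast
next
  fix Y assume "Y \<in> Poly_Mapping.nth ` set positive_roots"
  then obtain m where m: "m \<in> set positive_roots" and Y: "Y = Poly_Mapping.nth m" by blast
  have len: "length m = 8" and sq: "divisor_square m = -2 \<or> divisor_square m = -3"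
    using m by (auto simp: in_positive_roots)
  \<comment> \<open>A self-intersection of -2 or -3 rules out the zero divisor.\<close>
  have "intersection_form E8_1 0 0 = 0" by (simp add: intersection_form_def)
  then have "Y \<noteq> 0" using sq intersection_form_E8_1_nth[OF len] Y by auto
  moreover have "Poly_Mapping.keys Y \<subseteq> {0..7}"
    using len by (auto simp: Y in_keys_iff nth.rep_eq nth_default_def
        simp del: keys_nth split: if_splits)
  moreover have "0 \<le> Poly_Mapping.lookup Y v" for v
    using m by (auto simp: Y in_positive_roots nth.rep_eq nth_default_def)
  ultimately show "Y \<in> ?P"
    using sq intersection_form_E8_1_nth[OF len] Y by (simp add: positive_divisor_def E8_1_def)
qed

theorem proposition3p27:
  shows "card (triple_root_system E8_1) = 238"
proof -
  let ?P = "Poly_Mapping.nth ` set positive_roots"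
  have "inj_on Poly_Mapping.nth (set positive_roots)"
    by (rule inj_on_subset[OF inj_on_poly_mapping_nth[of 8]]) (auto simp: in_positive_roots)
  then have card: "card ?P = 119"
    by (simp add: card_image distinct_card distinct_positive_roots length_positive_roots)
  \<comment> \<open>In this form the description of \<open>?P\<close> in
    \<open>positive_roots_E8_1\<close> applies to \<open>- Y\<close> directly.\<close>
  have neg: "Y \<in> uminus ` ?P \<longleftrightarrow> - Y \<in> ?P" for Y
    by (metis (no_types, lifting) image_iff minus_minus)
  have "triple_root_system E8_1 = ?P \<union> uminus ` ?P"
    unfolding set_eq_iff Un_iff neg unfolding positive_roots_E8_1[symmetric]
    by (auto simp: triple_root_system_def negative_divisor_iff intersection_form_uminus)
  moreover have "?P \<inter> uminus ` ?P = {}"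
    unfolding disjoint_iff neg unfolding positive_roots_E8_1[symmetric]
    using positive_not_negative_divisor by (auto simp: negative_divisor_iff)
  moreover have "card (uminus ` ?P) = 119"
    using card by (simp add: card_image)
  ultimately show ?thesis
    using card by (simp add: card_Un_disjoint)
qed

end
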